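(* Let $(X,\mathcal L)$ be a covering clutter with $X=[d]$ in which all lines have the same size; let $s:=\{x\in\mathbb{R}^d:\sum_{j\in L}x_j=1\text{ for all }L\in\mathcal L\}$, $\mathcal O:=\mathbb{R}^d_{\ge0}$, $P:=s\cap\mathcal O$, $\Gamma_{\mathcal L}$ the graph joining any two distinct collinear points, and $\mathcal H:=\{h_{jk}\cap s : jk\text{ an edge of }\Gamma_{\mathcal L},\ h_{jk}\not\supseteq s\}$ with $h_{jk}$ the hyperplane $x_j=x_k$. Assume a positive latin labelling exists. Let $L_a^\circ(t)$ be the number of latin labellings with positive entries and all line sums equal to $t$, and $L_a(t)$ the number of pairs consisting of a nonnegative integer labelling with all line sums $t$ and an acyclic orientation of $\Gamma_{\mathcal L}$ compatible with it and realizable in $P^\circ$. Then $$L_a^\circ(t)=\sum_{u\in\mathcal L(P^\circ,\mathcal H)}\mu(\hat0,u)\,E_{u\cap\mathcal O^\circ}(t),\qquad L_a(t)=\sum_{u\in\mathcal L(P^\circ,\mathcal H)}|\mu(\hat0,u)|\,E_{u\cap\mathcal O}(t),$$ where $\mu$ is the Möbius function of $\mathcal L(P^\circ,\mathcal H)$.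
   Context: A covering clutter is a finite set $X$ with a family of nonempty subsets (lines), none containing another, whose union is $X$. A latin labelling has distinct values at any two distinct collinear points; a positive latin labelling is one with positive integer values and all line sums equal to a common $t$. Acyclic/compatible/realizable orientations: no directed cycle; $x_j\ge x_i$ for each edge $i\to j$; some $x$ in the set has $x_j>x_i$ for each edge $i\to j$. $\mathcal O^\circ$ is the open positive orthant, $P^\circ$ the relative interior of $P$. $\mathcal L(P^\circ,\mathcal H):=\{P^\circ\cap\bigcap\mathcal S:\mathcal S\subseteq\mathcal H\}\setminus\{\emptyset\}$ ordered by reverse inclusion with bottom $\hat0=P^\circ$; $E_{Q\cap u}(t)$ is the number of integer points in $t(Q\cap\bar u)$, where $\bar u=\bigcap\mathcal S$ is the flat whose intersection with $P^\circ$ is $u$. Möbius function: $\mu(r,r)=1$, $\mu(r,s)=-\sum_{r\le w<s}\mu(r,w)$ for $r<s$. *)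

theory Defs
  imports "HOL-Analysis.Analysis"
begin

definition covering_clutter :: "'a set \<Rightarrow> 'a set set \<Rightarrow> bool" where
  "covering_clutter X \<L> \<longleftrightarrow>
     finite X \<and>
     (\<forall>l\<in>\<L>. l \<noteq> {} \<and> l \<subseteq> X) \<and>
     (\<forall>l\<in>\<L>. \<forall>m\<in>\<L>. l \<subseteq> m \<longrightarrow> l = m) \<and>
     \<Union>\<L> = X"

definition same_line :: "'a set set \<Rightarrow> 'a \<Rightarrow> 'a \<Rightarrow> bool" where
  "same_line \<L> j k \<longleftrightarrow> (\<exists>l\<in>\<L>. j \<in> l \<and> k \<in> l)"

definition latin :: "'a set set \<Rightarrow> ('a \<Rightarrow> 'b) \<Rightarrow> bool" where
  "latin \<L> x \<longleftrightarrow> (\<forall>j k. j \<noteq> k \<and> same_line \<L> j k \<longrightarrow> x j \<noteq> x k)"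

definition all_line_sums :: "'a set set \<Rightarrow> ('a \<Rightarrow> int) \<Rightarrow> int \<Rightarrow> bool" where
  "all_line_sums \<L> x t \<longleftrightarrow> (\<forall>l\<in>\<L>. (\<Sum>j\<in>l. x j) = t)"

definition positive_latin :: "'a set set \<Rightarrow> ('a \<Rightarrow> int) \<Rightarrow> int \<Rightarrow> bool" where
  "positive_latin \<L> x t \<longleftrightarrow> latin \<L> x \<and> (\<forall>j. 0 < x j) \<and> all_line_sums \<L> x t"

definition collinearity_graph :: "'a set set \<Rightarrow> 'a set set" where
  "collinearity_graph \<L> = {{j, k} | j k. j \<noteq> k \<and> same_line \<L> j k}"

text \<open>A graph is given by its set of edges \<open>{i, j}\<close>; a pair \<open>(i, j)\<close> in an orientation
  stands for the directed edge from \<open>i\<close> to \<open>j\<close>.\<close>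

definition orientation :: "'a set set \<Rightarrow> ('a \<times> 'a) set \<Rightarrow> bool" where
  "orientation \<Gamma> \<alpha> \<longleftrightarrow>
     (\<forall>(i, j)\<in>\<alpha>. {i, j} \<in> \<Gamma>) \<and>
     (\<forall>i j. {i, j} \<in> \<Gamma> \<longrightarrow> ((i, j) \<in> \<alpha> \<longleftrightarrow> (j, i) \<notin> \<alpha>))"

definition compatible :: "('a \<times> 'a) set \<Rightarrow> ('a \<Rightarrow> int) \<Rightarrow> bool" where
  "compatible \<alpha> x \<longleftrightarrow> (\<forall>(i, j)\<in>\<alpha>. x i \<le> x j)"

definition realizable_in :: "('n::finite \<times> 'n) set \<Rightarrow> (real ^ 'n) set \<Rightarrow> bool" where
  "realizable_in \<alpha> A \<longleftrightarrow> (\<exists>x\<in>A. \<forall>(i, j)\<in>\<alpha>. x $ i < x $ j)"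

definition magic_space :: "'n::finite set set \<Rightarrow> (real ^ 'n) set" where
  "magic_space \<L> = {x. \<forall>l\<in>\<L>. (\<Sum>j\<in>l. x $ j) = 1}"

definition orthant :: "(real ^ 'n::finite) set" where
  "orthant = {x. \<forall>j. 0 \<le> x $ j}"

definition open_orthant :: "(real ^ 'n::finite) set" where
  "open_orthant = {x. \<forall>j. 0 < x $ j}"

definition magic_polytope :: "'n::finite set set \<Rightarrow> (real ^ 'n) set" where
  "magic_polytope \<L> = magic_space \<L> \<inter> orthant"

definition hyp :: "'n::finite \<Rightarrow> 'n \<Rightarrow> (real ^ 'n) set" where
  "hyp j k = {x. x $ j = x $ k}"

definition arrangement :: "'n::finite set set \<Rightarrow> (real ^ 'n) set set" where
  "arrangement \<L> =
     {hyp j k \<inter> magic_space \<L> | j k.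
        {j, k} \<in> collinearity_graph \<L> \<and> \<not> magic_space \<L> \<subseteq> hyp j k}"

definition intersection_poset :: "'a set \<Rightarrow> 'a set set \<Rightarrow> 'a set set" where
  "intersection_poset A \<H> = {A \<inter> \<Inter>\<S> | \<S>. \<S> \<subseteq> \<H>} - {{}}"

text \<open>The flat \<open>\<Inter>\<S>\<close> that cuts out \<open>u\<close> on \<open>A\<close>. The members of \<open>\<H>\<close> are hyperplanes of the
  affine space \<open>s\<close>, so the empty intersection is \<open>s\<close>. When \<open>A\<close> is nonempty and relatively
  open in \<open>s\<close>, the flat is determined by each nonempty \<open>u\<close>.\<close>

definition flat_of :: "'a set \<Rightarrow> 'a set \<Rightarrow> 'a set set \<Rightarrow> 'a set \<Rightarrow> 'a set" where
  "flat_of s A \<H> u = (THE f. \<exists>\<S>\<subseteq>\<H>. f = s \<inter> \<Inter>\<S> \<and> A \<inter> f = u)"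

text \<open>The Moebius function of a finite family \<open>F\<close> of sets ordered by reverse inclusion: the
  order relation \<open>r \<le> w < s\<close> of the poset reads \<open>s \<subset> w \<subseteq> r\<close>. It is \<open>0\<close> on incomparable
  arguments.\<close>

function poset_moebius :: "'a set set \<Rightarrow> 'a set \<Rightarrow> 'a set \<Rightarrow> int" where
  "poset_moebius F r s =
     (if r = s then 1
      else if finite F \<and> s \<subset> r then - (\<Sum>w\<in>{w\<in>F. s \<subset> w \<and> w \<subseteq> r}. poset_moebius F r w)
      else 0)"
  by pat_completeness auto
termination
proof (relation "Wellfounded.measure (\<lambda>(F, r, s). card {w\<in>F. s \<subset> w \<and> w \<subseteq> r})", goal_cases)
  case 1
  then show ?case by simp
next
  case (2 F r s w)
  then have "{v\<in>F. w \<subset> v \<and> v \<subseteq> r} \<subset> {v\<in>F. s \<subset> v \<and> v \<subseteq> r}"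
    by blast
  with 2 show ?case
    by (auto intro!: psubset_card_mono)
qed

declare poset_moebius.simps [simp del]

definition lattice_count :: "nat \<Rightarrow> (real ^ 'n::finite) set \<Rightarrow> nat" where
  "lattice_count t A = card {x. (\<forall>j. x $ j \<in> \<int>) \<and> x \<in> (\<lambda>y. real t *\<^sub>R y) ` A}"

definition positive_latin_count :: "'n::finite set set \<Rightarrow> nat \<Rightarrow> nat" where
  "positive_latin_count \<L> t = card {x. positive_latin \<L> x (int t)}"

definition oriented_labelling_count :: "'n::finite set set \<Rightarrow> nat \<Rightarrow> nat" where
  "oriented_labelling_count \<L> t =
     card {(x, \<alpha>).
       (\<forall>j. 0 \<le> x j) \<and> all_line_sums \<L> x (int t) \<and>
       orientation (collinearity_graph \<L>) \<alpha> \<and> acyclic \<alpha> \<and> compatible \<alpha> x \<and>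
       realizable_in \<alpha> (rel_interior (magic_polytope \<L>))}"

end

theory Submission
  imports Defs
begin

text \<open>
  By the crosscut theorem, \<open>\<mu>(0, u)\<close> is the alternating sum of \<open>(-1)\<^bsup>|S|\<^esup>\<close> over the sets \<open>S\<close>
  of hyperplanes that cut out \<open>u\<close>. Exchanging summations turns the first formula into
  inclusion-exclusion at each lattice point. Deletion and restriction show that these numbers
  alternate in sign with the dimension of \<open>u\<close> and that their absolute values add up to the number
  of regions of the open convex set, which is Zaslavsky's theorem. For the second formula this is
  applied, for each lattice point \<open>y\<close> of the closed polytope, to the hyperplanes through \<open>y\<close>: the
  flats containing \<open>y\<close> are the flats of that subarrangement, and its regions correspond to the
  regions of the whole arrangement whose closure contains \<open>y\<close>, that is, to the realizable
  orientations compatible with \<open>y\<close>.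
\<close>

section \<open>Moebius functions and alternating sums\<close>

text \<open>Isolating the term \<open>w = u\<close> expresses \<open>f u\<close> through the values
  at strictly larger sets, which is the recursion of \<open>poset_moebius\<close>. Computing a
  Moebius function thus reduces to checking these sums.\<close>

lemma poset_moebius_unique:
  fixes f :: "'a set \<Rightarrow> int"
  assumes "finite L" "r \<in> L" "\<And>w. w \<in> L \<Longrightarrow> w \<subseteq> r"
    and f: "\<And>u. u \<in> L \<Longrightarrow> (\<Sum>w\<in>{w\<in>L. u \<subseteq> w}. f w) = (if u = r then 1 else 0)"
    and "u \<in> L"
  shows "poset_moebius L r u = f u"
  using \<open>u \<in> L\<close>
proof (induction "card {w\<in>L. u \<subset> w}" arbitrary: u rule: less_induct)
  case less
  have split: "{w\<in>L. u \<subseteq> w} = insert u {w\<in>L. u \<subset> w}"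
    using less.prems by blast
  have sum: "f u + (\<Sum>w\<in>{w\<in>L. u \<subset> w}. f w) = (if u = r then 1 else 0)"
    using f[OF less.prems] unfolding split using assms(1) by simp
  show ?case
  proof (cases "u = r")
    case True
    then have "{w\<in>L. u \<subset> w} = {}"
      using assms(3) by blast
    with sum have "f u + sum f {} = 1"
      using True by (simp only: if_True refl)
    then show ?thesis
      by (subst poset_moebius.simps) (simp add: True)
  next
    case False
    then have "u \<subset> r"
      using assms(3) less.prems by blast
    have "poset_moebius L r w = f w" if "w \<in> L" "u \<subset> w" for w
    proof (rule less.hyps[OF _ that(1)])
      show "card {v\<in>L. w \<subset> v} < card {v\<in>L. u \<subset> v}"
        using that assms(1) by (intro psubset_card_mono) auto
    qed
    moreover have "{w\<in>L. u \<subset> w \<and> w \<subseteq> r} = {w\<in>L. u \<subset> w}"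
      using assms(3) by blast
    ultimately have "poset_moebius L r u = - (\<Sum>w\<in>{w\<in>L. u \<subset> w}. f w)"
      using \<open>u \<subset> r\<close> assms(1) by (subst poset_moebius.simps) auto
    then show ?thesis
      using sum False by simp
  qed
qed

lemma sum_Pow_insert:
  fixes g :: "'a set \<Rightarrow> 'b::comm_monoid_add"
  assumes "finite E" "e \<notin> E"
  shows "(\<Sum>S\<in>Pow (insert e E). g S) = (\<Sum>S\<in>Pow E. g S) + (\<Sum>S\<in>Pow E. g (insert e S))"
proof -
  have "inj_on (insert e) (Pow E)"
    using assms(2) by (auto simp: inj_on_def)
  moreover have "Pow E \<inter> insert e ` Pow E = {}"
    using assms(2) by auto
  ultimately show ?thesis
    using assms(1) by (simp add: Pow_insert sum.union_disjoint sum.reindex)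
qed

text \<open>For a fixed \<open>e\<close> in \<open>E\<close>, the subsets with and without
  \<open>e\<close> cancel in pairs.\<close>

lemma sum_Pow_alternating:
  assumes "finite E"
  shows "(\<Sum>S\<in>Pow E. (-1::int) ^ card S) = (if E = {} then 1 else 0)"
proof (cases "E = {}")
  case False
  then obtain e where e: "e \<in> E" by blast
  define E' where "E' = E - {e}"
  have E': "E = insert e E'" "e \<notin> E'" "finite E'"
    using e assms by (auto simp: E'_def)
  have "(\<Sum>S\<in>Pow E'. (-1::int) ^ card (insert e S)) = (\<Sum>S\<in>Pow E'. - ((-1) ^ card S))"
  proof (rule sum.cong[OF refl])
    fix S assume "S \<in> Pow E'"
    then have "e \<notin> S" "finite S"
      using E' finite_subset by auto
    then show "(-1::int) ^ card (insert e S) = - ((-1) ^ card S)" by simp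
  qed
  then show ?thesis
    using False unfolding E'(1) by (simp add: sum_Pow_insert E' sum_negf)
qed simp

lemma abs_diff_opposite_sign:
  fixes p q :: int
  assumes "0 \<le> (-1) ^ Suc n * p" "0 \<le> (-1) ^ n * q"
  shows "\<bar>p - q\<bar> = \<bar>p\<bar> + \<bar>q\<bar>"
  using assms by (cases "even n") auto

section \<open>Arrangements in an open convex set\<close>

text \<open>The hyperplanes form an indexed family, so different indices may give the same
  hyperplane or the same trace on a flat, as happens after restriction.\<close>

locale open_convex_arrangement =
  fixes C :: "'a::euclidean_space set" and a :: "'e \<Rightarrow> 'a" and b :: "'e \<Rightarrow> real"
  assumes open_C: "open C" and convex_C: "convex C"
begin

definition H :: "'e \<Rightarrow> 'a set" where
  "H e = {x. a e \<bullet> x = b e}"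

text \<open>The ambient space \<open>F\<close> is a parameter, so that restricting to a hyperplane
  replaces \<open>F\<close> by \<open>F \<inter> H e\<close> and keeps \<open>C\<close> and the
  indices.\<close>

definition flat :: "'a set \<Rightarrow> 'e set \<Rightarrow> 'a set" where
  "flat F S = F \<inter> (\<Inter>e\<in>S. H e)"

definition cut :: "'a set \<Rightarrow> 'e set \<Rightarrow> 'a set" where
  "cut F S = C \<inter> flat F S"

definition cuts :: "'a set \<Rightarrow> 'e set \<Rightarrow> 'a set set" where
  "cuts F E = cut F ` Pow E - {{}}"

text \<open>The alternating sum of Whitney's theorem. It agrees with the Moebius function when no
  hyperplane contains \<open>C \<inter> F\<close>, and obeys deletion and restriction in all
  cases.\<close>

definition whitney :: "'a set \<Rightarrow> 'e set \<Rightarrow> 'a set \<Rightarrow> int" where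
  "whitney F E u = (\<Sum>S\<in>Pow E. if cut F S = u then (-1) ^ card S else 0)"

definition sign_pattern :: "'e set \<Rightarrow> 'a \<Rightarrow> 'e set" where
  "sign_pattern E x = {e\<in>E. a e \<bullet> x > b e}"

text \<open>A region is encoded by the set of indices on whose positive side it lies; by convexity,
  the points of \<open>C \<inter> F\<close> off all hyperplanes with equal patterns form one
  region.\<close>

definition regions :: "'a set \<Rightarrow> 'e set \<Rightarrow> 'e set set" where
  "regions F E = sign_pattern E ` {x \<in> C \<inter> F. \<forall>e\<in>E. x \<notin> H e}"

section \<open>Flats and the cuts they make in the open convex set\<close>

lemma affine_H: "affine (H e)"
  unfolding H_def by (rule affine_hyperplane)

lemma affine_flat: "affine F \<Longrightarrow> affine (flat F S)"
  unfolding flat_def by (intro affine_Int affine_Inter) (auto simp: affine_H)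

text \<open>As \<open>C\<close> is open, a nonempty cut is relatively open in its flat and spans it.
  So the flat can be recovered from the cut.\<close>

lemma affine_hull_cut:
  assumes "affine F" "cut F S \<noteq> {}"
  shows "affine hull (cut F S) = flat F S"
  using affine_hull_affine_Int_open[OF affine_flat[OF assms(1)] open_C, of S] assms
  by (simp add: cut_def Int_commute affine_hull_eq affine_flat)

lemma cut_insert: "cut F (insert e S) = cut (F \<inter> H e) S"
  by (auto simp: cut_def flat_def)

lemma cut_empty [simp]: "cut F {} = C \<inter> F"
  by (simp add: cut_def flat_def)

lemma cut_subset: "cut F S \<subseteq> C \<inter> F"
  by (auto simp: cut_def flat_def)

lemma finite_cuts: "finite E \<Longrightarrow> finite (cuts F E)"
  by (simp add: cuts_def)

section \<open>Deletion, restriction and signs of Whitney sums\<close>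

lemma whitney_empty [simp]: "whitney F {} u = (if C \<inter> F = u then 1 else 0)"
  by (simp add: whitney_def)

lemma whitney_eq_0:
  assumes "\<And>S. S \<subseteq> E \<Longrightarrow> cut F S \<noteq> u"
  shows "whitney F E u = 0"
  unfolding whitney_def using assms by (intro sum.neutral) auto

lemma whitney_eq_0_disjoint:
  assumes "C \<inter> F = {}" "u \<noteq> {}"
  shows "whitney F E u = 0"
  using assms cut_subset by (intro whitney_eq_0) blast

text \<open>Deletion and restriction: the index sets containing \<open>e\<close> yield the sum for
  \<open>F \<inter> H e\<close>, with the sign reversed by the extra element.\<close>

lemma whitney_insert:
  assumes "finite E" "e \<notin> E"
  shows "whitney F (insert e E) u = whitney F E u - whitney (F \<inter> H e) E u"
proof -
  have "(\<Sum>S\<in>Pow E. if cut F (insert e S) = u then (-1) ^ card (insert e S) else 0)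
     = (\<Sum>S\<in>Pow E. - (if cut (F \<inter> H e) S = u then (-1) ^ card S else (0::int)))"
  proof (rule sum.cong[OF refl])
    fix S assume "S \<in> Pow E"
    then have "e \<notin> S" "finite S"
      using assms finite_subset by auto
    then show "(if cut F (insert e S) = u then (-1) ^ card (insert e S) else 0)
       = - (if cut (F \<inter> H e) S = u then (-1) ^ card S else (0::int))"
      by (simp add: cut_insert)
  qed
  then show ?thesis
    unfolding whitney_def by (simp add: sum_Pow_insert assms sum_negf)
qed

lemma whitney_cong_cut:
  assumes "C \<inter> F = C \<inter> G"
  shows "whitney F E u = whitney G E u"
proof -
  have "cut F S = cut G S" for S
    using assms unfolding cut_def flat_def by blast
  then show ?thesis by (simp add: whitney_def)
qed

text \<open>Deletion and restriction agree inside \<open>C\<close> and cancel.\<close>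

lemma whitney_insert_trivial:
  assumes "finite E" "e \<notin> E" "C \<inter> F \<subseteq> H e"
  shows "whitney F (insert e E) u = 0"
  using whitney_cong_cut[of F "F \<inter> H e" E u] assms by (auto simp: whitney_insert)

lemma aff_dim_Int_H:
  assumes "affine F" "C \<inter> F \<inter> H e \<noteq> {}" "\<not> C \<inter> F \<subseteq> H e"
  shows "aff_dim F = aff_dim (F \<inter> H e) + 1"
proof -
  have "F \<inter> H e \<noteq> {}" "\<not> F \<subseteq> H e"
    using assms by auto
  then show ?thesis
    using aff_dim_affine_Int_hyperplane[OF assms(1), of "a e" "b e"] by (auto simp: H_def)
qed

text \<open>Restriction lowers the dimension of \<open>F\<close> by one and enters with a minus
  sign, so both terms of the deletion-restriction formula have the same sign. The sum of the two
  dimensions has the parity of the codimension of \<open>u\<close>.\<close>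

lemma whitney_sign:
  assumes "finite E" "affine F" "u \<noteq> {}"
  shows "0 \<le> (-1) ^ (nat (aff_dim F) + nat (aff_dim u)) * whitney F E u"
  using assms(1,2)
proof (induction E arbitrary: F rule: finite_induct)
  case empty
  show ?case
  proof (cases "C \<inter> F = u")
    case True
    \<comment> \<open>Here \<open>u\<close> spans \<open>F\<close>, so the exponent is even and the
      sum is 1.\<close>
    then have "affine hull u = F"
      using affine_hull_cut[OF empty, of "{}"] assms(3) by (simp add: flat_def)
    then have "aff_dim u = aff_dim F"
      by (metis aff_dim_affine_hull)
    then show ?thesis
      by simp
  qed simp
next
  case (insert e E)
  have F': "affine (F \<inter> H e)"
    using insert.prems affine_H by (intro affine_Int)
  consider "C \<inter> F \<subseteq> H e" | "C \<inter> F \<inter> H e = {}" | "C \<inter> F \<inter> H e \<noteq> {}" "\<not> C \<inter> F \<subseteq> H e"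
    by blast
  then show ?case
  proof cases
    case 1
    then show ?thesis
      using insert.hyps by (simp add: whitney_insert_trivial)
  next
    case 2
    then have "whitney (F \<inter> H e) E u = 0"
      using assms(3) by (intro whitney_eq_0_disjoint) auto
    then show ?thesis
      using insert.IH[OF insert.prems] insert.hyps by (simp add: whitney_insert)
  next
    case 3
    \<comment> \<open>Excludes dimension -1, so that \<open>nat\<close> does not truncate and the
      parity really changes.\<close>
    have "0 \<le> aff_dim (F \<inter> H e)"
      using 3(1) by (metis Int_assoc Int_empty_right aff_dim_negative_iff linorder_not_le)
    then have "nat (aff_dim F) = Suc (nat (aff_dim (F \<inter> H e)))"
      using aff_dim_Int_H[OF insert.prems 3] by simp
    then show ?thesis
      using insert.IH[OF insert.prems] insert.IH[OF F'] insert.hyps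
      by (simp add: whitney_insert algebra_simps)
  qed
qed

text \<open>Deletion and restriction have opposite signs by \<open>whitney_sign\<close>, so their
  difference involves no cancellation.\<close>

lemma abs_whitney_insert:
  assumes "finite E" "e \<notin> E" "affine F" "u \<noteq> {}" "\<not> C \<inter> F \<subseteq> H e"
  shows "\<bar>whitney F (insert e E) u\<bar> = \<bar>whitney F E u\<bar> + \<bar>whitney (F \<inter> H e) E u\<bar>"
proof (cases "C \<inter> F \<inter> H e = {}")
  case True
  then have "whitney (F \<inter> H e) E u = 0"
    using assms(4) by (intro whitney_eq_0_disjoint) auto
  then show ?thesis
    using assms by (simp add: whitney_insert)
next
  case False
  have F': "affine (F \<inter> H e)"
    using assms affine_H by (intro affine_Int)
  have "0 \<le> aff_dim (F \<inter> H e)"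
    using False by (metis Int_assoc Int_empty_right aff_dim_negative_iff linorder_not_le)
  then have "nat (aff_dim F) = Suc (nat (aff_dim (F \<inter> H e)))"
    using aff_dim_Int_H[OF assms(3) False assms(5)] by simp
  then show ?thesis
    using whitney_sign[OF assms(1,3,4)] whitney_sign[OF assms(1) F' assms(4)] assms
      abs_diff_opposite_sign[of "nat (aff_dim (F \<inter> H e)) + nat (aff_dim u)"]
    by (simp add: whitney_insert)
qed

section \<open>Regions as sign patterns, and their number\<close>

lemma regions_subset: "regions F E \<subseteq> Pow E"
  by (auto simp: regions_def sign_pattern_def)

lemma in_regions_iff:
  "T \<in> regions F E \<longleftrightarrow>
     T \<subseteq> E \<and> (\<exists>x\<in>C \<inter> F. \<forall>e\<in>E. if e \<in> T then a e \<bullet> x > b e else a e \<bullet> x < b e)"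
proof
  assume "T \<in> regions F E"
  then show "T \<subseteq> E \<and> (\<exists>x\<in>C \<inter> F. \<forall>e\<in>E. if e \<in> T then a e \<bullet> x > b e else a e \<bullet> x < b e)"
    by (force simp: regions_def sign_pattern_def H_def)
next
  assume R: "T \<subseteq> E \<and> (\<exists>x\<in>C \<inter> F. \<forall>e\<in>E. if e \<in> T then a e \<bullet> x > b e else a e \<bullet> x < b e)"
  then obtain x where x: "x \<in> C \<inter> F" "\<And>e. e \<in> E \<Longrightarrow> if e \<in> T then a e \<bullet> x > b e else a e \<bullet> x < b e"
    by blast
  have "T = sign_pattern E x"
    using R x(2) unfolding sign_pattern_def by (auto split: if_splits)
      (metis less_asym)
  moreover have "x \<notin> H e" if "e \<in> E" for e
    using x(2)[OF that] by (auto simp: H_def split: if_splits)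
  ultimately show "T \<in> regions F E"
    using x(1) unfolding regions_def by blast
qed

lemma open_cell:
  assumes "finite E"
  shows "open {x. \<forall>e\<in>E. if e \<in> T then a e \<bullet> x > b e else a e \<bullet> x < b e}" (is "open ?U")
proof -
  have "?U = (\<Inter>e\<in>E. if e \<in> T then {x. a e \<bullet> x > b e} else {x. a e \<bullet> x < b e})"
    by (auto split: if_splits)
  then show ?thesis
    using assms by (auto intro!: open_INT simp: open_halfspace_gt open_halfspace_lt)
qed

lemma convex_cell:
  "convex {x. \<forall>e\<in>E. if e \<in> T then a e \<bullet> x > b e else a e \<bullet> x < b e}" (is "convex ?U")
proof -
  have eq: "?U = (\<Inter>e\<in>E. if e \<in> T then {x. a e \<bullet> x > b e} else {x. a e \<bullet> x < b e})"
    by (auto split: if_splits)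
  show ?thesis
    unfolding eq by (intro convex_INT) (simp add: convex_halfspace_gt convex_halfspace_lt)
qed

text \<open>On the line from \<open>p\<close> through \<open>q\<close>, which stays in
  \<open>F\<close>, the form \<open>a e\<close> is affine and not constant, and takes the value
  \<open>b e\<close> at \<open>p\<close>. Small steps in both directions stay in the open set
  \<open>U\<close>.\<close>

lemma both_sides:
  assumes "open U" "affine F" "p \<in> U \<inter> F" "p \<in> H e" "q \<in> F" "q \<notin> H e"
  shows "\<exists>x\<in>U \<inter> F. a e \<bullet> x > b e" "\<exists>x\<in>U \<inter> F. a e \<bullet> x < b e"
proof -
  define c where "c = (\<lambda>r::real. p + r *\<^sub>R (q - p))"
  have "open (c -` U)"
    using assms(1) by (intro open_vimage) (auto simp: c_def intro!: continuous_intros)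
  moreover have "0 \<in> c -` U"
    using assms(3) by (simp add: c_def)
  ultimately obtain d where d: "d > 0" "ball 0 d \<subseteq> c -` U"
    by (meson open_contains_ball)
  have U: "c (d/2) \<in> U" "c (-d/2) \<in> U"
    using d by (auto simp: subset_iff dist_norm)
  have cF: "c r \<in> F" for r
  proof -
    have "(1 - r) *\<^sub>R p + r *\<^sub>R q \<in> F"
      using assms by (intro mem_affine) auto
    then show ?thesis by (simp add: c_def algebra_simps)
  qed
  have val: "a e \<bullet> c r = b e + r * (a e \<bullet> q - b e)" for r
    using assms(4) by (simp add: c_def H_def inner_add_right inner_diff_right)
  have "a e \<bullet> q - b e > 0 \<or> a e \<bullet> q - b e < 0"
    using assms(6) by (auto simp: H_def)
  then have "(a e \<bullet> c (d/2) > b e \<and> a e \<bullet> c (-d/2) < b e) \<or> (a e \<bullet> c (d/2) < b e \<and> a e \<bullet> c (-d/2) > b e)"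
    unfolding val using d(1) by (auto simp: mult_pos_neg)
  then show "\<exists>x\<in>U \<inter> F. a e \<bullet> x > b e" "\<exists>x\<in>U \<inter> F. a e \<bullet> x < b e"
    using U cF by blast+
qed

lemma convex_crosses_H:
  assumes "convex K" "x \<in> K" "y \<in> K" "a e \<bullet> x > b e" "a e \<bullet> y < b e"
  shows "\<exists>z\<in>K. z \<in> H e"
proof -
  \<comment> \<open>The solution of the linear equation saying that
    \<open>(1 - r) *\<^sub>R x + r *\<^sub>R y\<close> lies on \<open>H e\<close>.\<close>
  define r where "r = (a e \<bullet> x - b e) / (a e \<bullet> x - a e \<bullet> y)"
  have r: "0 \<le> r" "r \<le> 1" "r * (a e \<bullet> x - a e \<bullet> y) = a e \<bullet> x - b e"
    using assms by (auto simp: r_def field_simps)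
  have "(1 - r) *\<^sub>R x + r *\<^sub>R y \<in> K"
    using assms r by (intro convexD_alt) auto
  moreover have "a e \<bullet> ((1 - r) *\<^sub>R x + r *\<^sub>R y) = b e"
    using r(3) by (simp add: inner_add_right algebra_simps)
  ultimately show ?thesis
    by (auto simp: H_def)
qed

text \<open>The region with sign pattern \<open>T\<close> over \<open>E\<close> extends to both sides of \<open>H e\<close> exactly when it
  meets \<open>H e\<close>: convexity gives one direction, relative openness the other.\<close>

lemma card_regions_insert:
  assumes "finite E" "e \<notin> E" "affine F" "\<not> C \<inter> F \<subseteq> H e"
  shows "card (regions F (insert e E)) = card (regions F E) + card (regions (F \<inter> H e) E)"
proof -
  define cell where "cell = (\<lambda>T. {x. \<forall>e\<in>E. if e \<in> T then a e \<bullet> x > b e else a e \<bullet> x < b e})"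
  \<comment> \<open>Patterns whose cell reaches the positive side of \<open>H e\<close>, and below
    those reaching the negative side. The lemma becomes the count of a union and an intersection:
    old regions are \<open>Rp \<union> Rm\<close>, regions of the restriction are
    \<open>Rp \<inter> Rm\<close>.\<close>
  define Rp where "Rp = {T. T \<subseteq> E \<and> (\<exists>x\<in>(C \<inter> cell T) \<inter> F. a e \<bullet> x > b e)}"
  define Rm where "Rm = {T. T \<subseteq> E \<and> (\<exists>x\<in>(C \<inter> cell T) \<inter> F. a e \<bullet> x < b e)}"
  have iff: "T \<in> regions G E \<longleftrightarrow> T \<subseteq> E \<and> (\<exists>x. x \<in> (C \<inter> cell T) \<inter> G)" for T G
    unfolding in_regions_iff cell_def by blast
  have fin: "finite Rp" "finite Rm"
    using assms(1) by (auto simp: Rp_def Rm_def)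
  obtain q where q: "q \<in> F" "q \<notin> H e"
    using assms(4) by blast
  have "open (C \<inter> cell T)" for T
    unfolding cell_def by (intro open_Int open_C open_cell assms(1))
  then have both: "T \<in> Rp \<and> T \<in> Rm" if "T \<subseteq> E" "p \<in> (C \<inter> cell T) \<inter> F" "p \<in> H e" for T p
    using both_sides[OF _ assms(3) that(2,3) q] that(1) by (simp add: Rp_def Rm_def)
  have cvx: "convex ((C \<inter> cell T) \<inter> F)" for T
    unfolding cell_def by (intro convex_Int convex_C convex_cell affine_imp_convex assms(3))
  have cross: "\<exists>z\<in>(C \<inter> cell T) \<inter> F. z \<in> H e" if T: "T \<in> Rp" "T \<in> Rm" for T
  proof -
    obtain x y where "x \<in> (C \<inter> cell T) \<inter> F" "a e \<bullet> x > b e" "y \<in> (C \<inter> cell T) \<inter> F" "a e \<bullet> y < b e"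
      using T unfolding Rp_def Rm_def by blast
    then show ?thesis
      using convex_crosses_H[OF cvx] by meson
  qed
  have Un: "Rp \<union> Rm = regions F E"
  proof (intro equalityI subsetI)
    fix T assume "T \<in> regions F E"
    then obtain x where x: "T \<subseteq> E" "x \<in> (C \<inter> cell T) \<inter> F"
      unfolding iff by blast
    show "T \<in> Rp \<union> Rm"
    proof (cases "x \<in> H e")
      case True
      then show ?thesis using both x by blast
    next
      case False
      then have "a e \<bullet> x > b e \<or> a e \<bullet> x < b e"
        by (auto simp: H_def)
      then show ?thesis
        using x unfolding Rp_def Rm_def by blast
    qed
  next
    fix T assume "T \<in> Rp \<union> Rm"
    then show "T \<in> regions F E"
      unfolding iff Rp_def Rm_def by blast
  qed
  have Int: "Rp \<inter> Rm = regions (F \<inter> H e) E"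
  proof (intro equalityI subsetI)
    fix T assume T: "T \<in> Rp \<inter> Rm"
    then obtain z where "z \<in> (C \<inter> cell T) \<inter> F" "z \<in> H e"
      using cross by blast
    moreover have "T \<subseteq> E"
      using T by (simp add: Rp_def)
    ultimately show "T \<in> regions (F \<inter> H e) E"
      unfolding iff by blast
  next
    fix T assume "T \<in> regions (F \<inter> H e) E"
    then show "T \<in> Rp \<inter> Rm"
      using both unfolding iff by blast
  qed
  \<comment> \<open>A new region is an old pattern with a chosen side of \<open>H e\<close>; the
    positive side is recorded by adding \<open>e\<close>.\<close>
  have ins: "regions F (insert e E) = insert e ` Rp \<union> Rm"
  proof (intro equalityI subsetI)
    fix T assume "T \<in> regions F (insert e E)"
    then obtain x where T: "T \<subseteq> insert e E" and x: "x \<in> C \<inter> F"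
      "\<And>i. i \<in> insert e E \<Longrightarrow> if i \<in> T then a i \<bullet> x > b i else a i \<bullet> x < b i"
      unfolding in_regions_iff by blast
    show "T \<in> insert e ` Rp \<union> Rm"
    proof (cases "e \<in> T")
      case True
      have "x \<in> cell (T - {e})"
        using x(2) assms(2) by (auto simp: cell_def)
      moreover have "a e \<bullet> x > b e"
        using x(2)[of e] True by simp
      ultimately have "T - {e} \<in> Rp"
        using T x(1) unfolding Rp_def by blast
      moreover have "T = insert e (T - {e})"
        using True by blast
      ultimately show ?thesis by blast
    next
      case False
      have "x \<in> cell T"
        using x(2) by (auto simp: cell_def)
      moreover have "a e \<bullet> x < b e"
        using x(2)[of e] False by simp
      ultimately have "T \<in> Rm"
        using T x(1) False unfolding Rm_def by blast
      then show ?thesis by blast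
    qed
  next
    fix T assume "T \<in> insert e ` Rp \<union> Rm"
    then consider T' where "T' \<in> Rp" "T = insert e T'" | "T \<in> Rm"
      by blast
    then show "T \<in> regions F (insert e E)"
    proof cases
      case 1
      then obtain x where "T' \<subseteq> E" "x \<in> C \<inter> F" "x \<in> cell T'" "a e \<bullet> x > b e"
        unfolding Rp_def by blast
      moreover from this have "\<forall>i\<in>insert e E. if i \<in> T then a i \<bullet> x > b i else a i \<bullet> x < b i"
        using assms(2) by (auto simp: cell_def 1)
      ultimately show ?thesis
        unfolding in_regions_iff using 1 by blast
    next
      case 2
      then obtain x where "T \<subseteq> E" "x \<in> C \<inter> F" "x \<in> cell T" "a e \<bullet> x < b e"
        unfolding Rm_def by blast
      moreover from this have "\<forall>i\<in>insert e E. if i \<in> T then a i \<bullet> x > b i else a i \<bullet> x < b i"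
        using assms(2) by (auto simp: cell_def)
      ultimately show ?thesis
        unfolding in_regions_iff by blast
    qed
  qed
  have "e \<notin> T" if "T \<in> Rp \<union> Rm" for T
    using that assms(2) by (auto simp: Rp_def Rm_def)
  then have "insert e ` Rp \<inter> Rm = {}" "inj_on (insert e) Rp"
    by (blast, intro inj_onI, metis UnI1 insert_ident)
  then have "card (regions F (insert e E)) = card Rp + card Rm"
    unfolding ins using fin by (simp add: card_Un_disjoint card_image)
  also have "\<dots> = card (Rp \<union> Rm) + card (Rp \<inter> Rm)"
    using fin by (rule card_Un_Int)
  finally show ?thesis
    unfolding Un Int .
qed

text \<open>Zaslavsky's theorem, for the part of an arrangement inside an open convex set.\<close>

lemma card_regions_eq_sum_whitney:
  assumes "finite E" "affine F" "finite U" "{} \<notin> U" "cuts F E \<subseteq> U"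
  shows "int (card (regions F E)) = (\<Sum>u\<in>U. \<bar>whitney F E u\<bar>)"
  \<comment> \<open>\<open>U\<close> stays fixed while \<open>F\<close> varies: it contains the cuts
    of both the deletion and the restriction, so all sums have one index set. Coefficients outside
    the cuts are 0.\<close>
  using assms(1,2,5)
proof (induction E arbitrary: F rule: finite_induct)
  case empty
  show ?case
  proof (cases "C \<inter> F = {}")
    case True
    then have "regions F {} = {}"
      by (auto simp: regions_def)
    moreover have "(\<Sum>u\<in>U. \<bar>whitney F {} u\<bar>) = 0"
      using True assms(4) by (intro sum.neutral) auto
    ultimately show ?thesis by simp
  next
    case False
    then have "C \<inter> F \<in> U"
      using empty.prems by (auto simp: cuts_def)
    moreover have "regions F {} = {{}}"
      using False by (auto simp: regions_def sign_pattern_def)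
    moreover have "(\<Sum>u\<in>U. \<bar>whitney F {} u\<bar>) = (\<Sum>u\<in>U. if C \<inter> F = u then 1 else 0)"
      by (intro sum.cong) auto
    ultimately show ?thesis
      using assms(3) by simp
  qed
next
  case (insert e E)
  show ?case
  proof (cases "C \<inter> F \<subseteq> H e")
    case True
    then have "regions F (insert e E) = {}"
      by (auto simp: regions_def)
    then show ?thesis
      using True insert.hyps by (simp add: whitney_insert_trivial)
  next
    case False
    have F': "affine (F \<inter> H e)"
      using insert.prems(1) affine_H by (intro affine_Int)
    have sub: "cuts F E \<subseteq> U"
      using insert.prems(2) by (auto simp: cuts_def)
    have sub': "cuts (F \<inter> H e) E \<subseteq> U"
    proof
      fix u assume "u \<in> cuts (F \<inter> H e) E"
      then obtain S where "S \<subseteq> E" "u = cut F (insert e S)" "u \<noteq> {}"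
        by (auto simp: cuts_def cut_insert)
      then have "u \<in> cuts F (insert e E)"
        unfolding cuts_def by blast
      then show "u \<in> U"
        using insert.prems(2) by blast
    qed
    have "(\<Sum>u\<in>U. \<bar>whitney F (insert e E) u\<bar>) =
        (\<Sum>u\<in>U. \<bar>whitney F E u\<bar> + \<bar>whitney (F \<inter> H e) E u\<bar>)"
      using assms(4) False insert.hyps insert.prems(1)
      by (intro sum.cong[OF refl] abs_whitney_insert) auto
    then show ?thesis
      using insert.IH[OF insert.prems(1) sub] insert.IH[OF F' sub']
        card_regions_insert[OF insert.hyps insert.prems(1) False]
      by (simp add: sum.distrib)
  qed
qed

section \<open>The crosscut formula for the Moebius function\<close>

text \<open>The index sets whose cut contains \<open>K\<close> are the subsets of those hyperplanes
  that contain \<open>K\<close>, so the sum is a full alternating sum. A cut as \<open>K\<close>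
  gives the Moebius recursion; a single point gives inclusion-exclusion there.\<close>

lemma sum_whitney_superset:
  assumes "finite E" "K \<noteq> {}" "K \<subseteq> C \<inter> F"
  shows "(\<Sum>w\<in>{w\<in>cuts F E. K \<subseteq> w}. whitney F E w) = (if \<forall>e\<in>E. \<not> K \<subseteq> H e then 1 else 0)"
proof -
  define E' where "E' = {e\<in>E. K \<subseteq> H e}"
  let ?W = "{w\<in>cuts F E. K \<subseteq> w}"
  have mem: "cut F S \<in> ?W \<longleftrightarrow> S \<in> Pow E'" if "S \<in> Pow E" for S
  proof -
    have "K \<subseteq> cut F S \<longleftrightarrow> S \<subseteq> E'"
      using that assms(3) by (auto simp: cut_def flat_def E'_def)
    \<comment> \<open>Since \<open>K\<close> is nonempty, a cut containing it is nonempty and so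
      survives the removal of \<open>{}\<close>.\<close>
    then show ?thesis
      using that assms(2) by (auto simp: cuts_def)
  qed
  have W: "finite ?W"
    using finite_cuts[OF assms(1)] by simp
  have "(\<Sum>w\<in>?W. whitney F E w) = (\<Sum>S\<in>Pow E. \<Sum>w\<in>?W. if cut F S = w then (-1) ^ card S else 0)"
    unfolding whitney_def by (rule sum.swap)
  also have "\<dots> = (\<Sum>S\<in>Pow E. if S \<in> Pow E' then (-1) ^ card S else 0)"
    using W by (intro sum.cong[OF refl]) (simp only: sum.delta' mem)
  also have "\<dots> = (\<Sum>S\<in>Pow E'. (-1) ^ card S)"
    using assms(1) by (subst sum.inter_restrict[symmetric]) (auto simp: E'_def intro!: sum.cong)
  also have "\<dots> = (if E' = {} then 1 else 0)"
    using assms(1) by (intro sum_Pow_alternating) (simp add: E'_def)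
  finally show ?thesis
    by (auto simp: E'_def)
qed

text \<open>The crosscut theorem: a cut lies in no hyperplane exactly when it is the bottom
  \<open>C \<inter> F\<close>, so \<open>sum_whitney_superset\<close> gives the equations that
  determine the Moebius function.\<close>

lemma moebius_eq_whitney:
  assumes "finite E" "C \<inter> F \<noteq> {}" "\<And>e. e \<in> E \<Longrightarrow> \<not> C \<inter> F \<subseteq> H e" "u \<in> cuts F E"
  shows "poset_moebius (cuts F E) (C \<inter> F) u = whitney F E u"
proof (rule poset_moebius_unique[OF finite_cuts[OF assms(1)] _ _ _ assms(4)])
  show "C \<inter> F \<in> cuts F E"
    using assms(2) cut_empty[of F] unfolding cuts_def by blast
  show "w \<subseteq> C \<inter> F" if "w \<in> cuts F E" for w
    using that cut_subset unfolding cuts_def by blast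
  fix v assume v: "v \<in> cuts F E"
  then obtain S where S: "S \<subseteq> E" "v = cut F S" "v \<noteq> {}"
    unfolding cuts_def by blast
  have "(\<forall>e\<in>E. \<not> v \<subseteq> H e) \<longleftrightarrow> v = C \<inter> F"
  proof
    assume "\<forall>e\<in>E. \<not> v \<subseteq> H e"
    then have "S = {}"
      using S by (auto simp: cut_def flat_def)
    then show "v = C \<inter> F"
      using S by simp
  qed (use assms(3) in blast)
  then show "(\<Sum>w\<in>{w \<in> cuts F E. v \<subseteq> w}. whitney F E w) = (if v = C \<inter> F then 1 else 0)"
    using sum_whitney_superset[OF assms(1) S(3), of F] S(2) cut_subset[of F S] by simp
qed

section \<open>Localization at a point of the closure\<close>

text \<open>The hull of \<open>u\<close> is the flat of every \<open>S\<close> that cuts out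
  \<open>u\<close>. If it contains \<open>y\<close>, each such \<open>S\<close> uses only
  hyperplanes through \<open>y\<close>; if not, no set of hyperplanes through \<open>y\<close> cuts
  out \<open>u\<close>.\<close>

lemma whitney_localize:
  assumes "finite E" "affine F" "u \<noteq> {}" "y \<in> F"
  shows "whitney F {e\<in>E. y \<in> H e} u = (if y \<in> affine hull u then whitney F E u else 0)"
proof (cases "y \<in> affine hull u")
  case True
  have "S \<subseteq> {e\<in>E. y \<in> H e}" if "S \<subseteq> E" "cut F S = u" for S
    using True affine_hull_cut[OF assms(2), of S] that assms(3) by (auto simp: flat_def)
  then have "whitney F E u = (\<Sum>S\<in>Pow {e\<in>E. y \<in> H e}. if cut F S = u then (-1) ^ card S else 0)"
    unfolding whitney_def using assms(1) by (intro sum.mono_neutral_right) auto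
  then show ?thesis
    using True by (simp add: whitney_def)
next
  case False
  have "cut F S \<noteq> u" if "S \<subseteq> {e\<in>E. y \<in> H e}" for S
  proof
    assume "cut F S = u"
    then have "affine hull u = flat F S"
      using affine_hull_cut[OF assms(2), of S] assms(3) by auto
    then show False
      using False that assms(4) by (auto simp: flat_def)
  qed
  then show ?thesis
    using False by (simp add: whitney_eq_0)
qed

text \<open>Moving from a point of a local region towards \<open>y\<close> keeps the signs with respect to the
  hyperplanes through \<open>y\<close> and eventually gives all others the sign they have at \<open>y\<close>.\<close>

lemma card_regions_at:
  assumes "finite E" "affine F" "y \<in> F" "y \<in> closure C"
  shows "card {T \<in> regions F E. \<forall>e\<in>E. if e \<in> T then a e \<bullet> y \<ge> b e else a e \<bullet> y \<le> b e}
       = card (regions F {e\<in>E. y \<in> H e})"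
    (is "card ?R = card (regions F ?E)")
\<comment> \<open>The bijection forgets the hyperplanes missing \<open>y\<close>; their signs are
  forced by \<open>y\<close>.\<close>
proof (rule bij_betw_same_card[of "\<lambda>T. T \<inter> ?E"], rule bij_betw_imageI)
  show "inj_on (\<lambda>T. T \<inter> ?E) ?R"
  proof (rule inj_onI)
    fix T T' assume T: "T \<in> ?R" and T': "T' \<in> ?R" and eq: "T \<inter> ?E = T' \<inter> ?E"
    have "e \<in> T \<longleftrightarrow> e \<in> T'" if "e \<in> E" for e
    proof (cases "y \<in> H e")
      case True
      then show ?thesis using eq that by blast
    next
      case False
      then have "a e \<bullet> y \<noteq> b e"
        by (simp add: H_def)
      moreover have "if e \<in> T then a e \<bullet> y \<ge> b e else a e \<bullet> y \<le> b e"
        "if e \<in> T' then a e \<bullet> y \<ge> b e else a e \<bullet> y \<le> b e"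
        using T T' that by blast+
      ultimately show ?thesis
        by (auto split: if_splits)
    qed
    then show "T = T'"
      using T T' regions_subset by blast
  qed
  show "(\<lambda>T. T \<inter> ?E) ` ?R = regions F ?E"
  proof (intro equalityI subsetI)
    fix T assume "T \<in> (\<lambda>T. T \<inter> ?E) ` ?R"
    then obtain T' where T': "T' \<in> regions F E" "T = T' \<inter> ?E"
      by blast
    then obtain x where x: "x \<in> C \<inter> F"
      "\<And>e. e \<in> E \<Longrightarrow> if e \<in> T' then a e \<bullet> x > b e else a e \<bullet> x < b e"
      unfolding in_regions_iff by blast
    have "if e \<in> T then a e \<bullet> x > b e else a e \<bullet> x < b e" if "e \<in> ?E" for e
      using x(2)[of e] that T'(2) by simp
    then show "T \<in> regions F ?E"
      unfolding in_regions_iff using x(1) T'(2) by blast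
  next
    fix T assume "T \<in> regions F ?E"
    then obtain p where p: "T \<subseteq> ?E" "p \<in> C" "p \<in> F"
      "\<And>e. e \<in> ?E \<Longrightarrow> if e \<in> T then a e \<bullet> p > b e else a e \<bullet> p < b e"
      unfolding in_regions_iff by blast
    \<comment> \<open>The inverse map: signs of \<open>p\<close> on hyperplanes through
      \<open>y\<close>, signs of \<open>y\<close> on all others. The point \<open>c r\<close>
      realizes this pattern for small positive \<open>r\<close>.\<close>
    define T' where "T' = T \<union> {e\<in>E. a e \<bullet> y > b e}"
    define c where "c = (\<lambda>r::real. y - r *\<^sub>R (y - p))"
    have cval: "a e \<bullet> c r = (1 - r) * (a e \<bullet> y) + r * (a e \<bullet> p)" for e r
      by (simp add: c_def inner_diff_right algebra_simps)
    have "\<forall>\<^sub>F r in at_right 0. if e \<in> T' then a e \<bullet> c r > b e else a e \<bullet> c r < b e"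
      if "e \<in> E" for e
    proof -
      have lim: "((\<lambda>r. a e \<bullet> c r) \<longlongrightarrow> a e \<bullet> c 0) (at_right 0)"
        unfolding c_def by (intro tendsto_intros)
      consider "y \<in> H e" | "a e \<bullet> y > b e" | "a e \<bullet> y < b e"
        by (force simp: H_def)
      then show ?thesis
      proof cases
        case 1
        then have "e \<in> ?E" and y: "a e \<bullet> y = b e"
          using that by (auto simp: H_def)
        then have "if e \<in> T' then a e \<bullet> p - b e > 0 else a e \<bullet> p - b e < 0"
          using p(4)[of e] by (auto simp: T'_def)
        then have "if e \<in> T' then a e \<bullet> c r > b e else a e \<bullet> c r < b e" if "r > 0" for r
          using mult_pos_pos[of r "a e \<bullet> p - b e"] mult_pos_neg[of r "a e \<bullet> p - b e"] that
          unfolding cval y by (auto simp: algebra_simps)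
        then show ?thesis
          using eventually_at_right_less[of "0::real"] by (rule eventually_mono[rotated])
      next
        case 2
        then have "e \<in> T'"
          using that by (simp add: T'_def)
        moreover have "\<forall>\<^sub>F r in at_right 0. a e \<bullet> c r > b e"
          using lim 2 by (intro order_tendstoD(1)) (auto simp: c_def)
        ultimately show ?thesis
          by simp
      next
        case 3
        then have "e \<notin> T'"
          using p(1) by (auto simp: T'_def H_def)
        moreover have "\<forall>\<^sub>F r in at_right 0. a e \<bullet> c r < b e"
          using lim 3 by (intro order_tendstoD(2)) (auto simp: c_def)
        ultimately show ?thesis
          by simp
      qed
    qed
    then have "\<forall>\<^sub>F r in at_right 0. \<forall>e\<in>E. if e \<in> T' then a e \<bullet> c r > b e else a e \<bullet> c r < b e"
      using assms(1) by (simp add: eventually_ball_finite_distrib)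
    moreover have "\<forall>\<^sub>F r in at_right 0. r \<in> {0<..<1::real}"
      by (rule eventually_at_right_real) simp
    ultimately have "\<forall>\<^sub>F r in at_right 0. 0 < r \<and> r < 1 \<and>
        (\<forall>e\<in>E. if e \<in> T' then a e \<bullet> c r > b e else a e \<bullet> c r < b e)"
      by eventually_elim auto
    then obtain r where r: "0 < r" "r < 1"
      "\<forall>e\<in>E. if e \<in> T' then a e \<bullet> c r > b e else a e \<bullet> c r < b e"
      using eventually_happens[of _ "at_right (0::real)"] by (auto simp: trivial_limit_at_right_real)
    \<comment> \<open>\<open>y\<close> is only in the closure of \<open>C\<close>, but a segment
      from it to an interior point is interior apart from the end \<open>y\<close>.\<close>
    have "c r \<in> interior C"
      unfolding c_def using p(2) open_C assms(4) r
      by (intro mem_interior_closure_convex_shrink[OF convex_C]) (auto simp: interior_open)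
    moreover have "(1 - r) *\<^sub>R y + r *\<^sub>R p \<in> F"
      using assms p by (intro mem_affine) auto
    then have "c r \<in> F"
      by (simp add: c_def algebra_simps)
    ultimately have "c r \<in> C \<inter> F"
      using interior_subset by blast
    moreover have "T' \<subseteq> E"
      using p(1) by (auto simp: T'_def)
    ultimately have "T' \<in> regions F E"
      unfolding in_regions_iff using r(3) by blast
    moreover have "if e \<in> T' then a e \<bullet> y \<ge> b e else a e \<bullet> y \<le> b e" if "e \<in> E" for e
      using that p(1) by (auto simp: T'_def H_def)
    moreover have "T = T' \<inter> ?E"
      using p(1) by (auto simp: T'_def H_def)
    ultimately show "T \<in> (\<lambda>T. T \<inter> ?E) ` ?R"
      by blast
  qed
qed

end

section \<open>Magic labellings\<close>

lemma open_open_orthant: "open (open_orthant :: (real ^ 'n::finite) set)"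
proof -
  have eq: "open_orthant = (\<Inter>j. {x::real^'n. x $ j > 0})"
    by (auto simp: open_orthant_def)
  show ?thesis
    unfolding eq by (intro open_INT) (auto simp: open_halfspace_component_gt_cart)
qed

lemma convex_open_orthant: "convex (open_orthant :: (real ^ 'n::finite) set)"
proof -
  have eq: "open_orthant = (\<Inter>j. {x::real^'n. axis j 1 \<bullet> x > 0})"
    by (auto simp: open_orthant_def inner_axis')
  show ?thesis
    unfolding eq by (intro convex_INT convex_halfspace_gt)
qed

text \<open>The affine space meets the interior of the orthant, so taking relative interiors
  commutes with the intersection.\<close>

lemma rel_interior_affine_Int_orthant:
  fixes F :: "(real ^ 'n::finite) set"
  assumes "affine F" "F \<inter> open_orthant \<noteq> {}"
  shows "rel_interior (F \<inter> orthant) = F \<inter> open_orthant"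
proof -
  have int: "interior orthant = (open_orthant :: (real^'n) set)"
  proof (intro equalityI subsetI)
    fix x :: "real^'n" assume "x \<in> interior orthant"
    then obtain e where e: "e > 0" "ball x e \<subseteq> orthant"
      by (meson mem_interior)
    have "0 < x $ j" for j
    proof -
      \<comment> \<open>Lowering coordinate \<open>j\<close> by \<open>e/2\<close> stays in the
        ball, hence in the orthant, so that coordinate is at least \<open>e/2\<close>.\<close>
      have "axis j (e/2) = (e/2) *\<^sub>R (axis j 1 :: real^'n)"
        by (simp add: vec_eq_iff axis_def)
      then have "x - axis j (e/2) \<in> ball x e"
        using e(1) by (simp add: dist_norm)
      then have "x - axis j (e/2) \<in> orthant"
        using e(2) by blast
      then have "0 \<le> (x - axis j (e/2)) $ j"
        unfolding orthant_def by blast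
      then show ?thesis
        using e(1) by (simp add: axis_def)
    qed
    then show "x \<in> open_orthant"
      by (simp add: open_orthant_def)
  next
    have "open_orthant \<subseteq> interior (orthant :: (real^'n) set)"
      by (intro interior_maximal open_open_orthant) (auto simp: open_orthant_def orthant_def less_imp_le)
    then show "x \<in> interior orthant" if "x \<in> open_orthant" for x :: "real^'n"
      using that by blast
  qed
  have cvx: "convex (orthant :: (real^'n) set)"
    by (auto simp: convex_def orthant_def)
  have rel: "rel_interior orthant = (open_orthant :: (real^'n) set)"
    using int assms(2) by (subst rel_interior_nonempty_interior) auto
  show ?thesis
    using convex_affine_rel_interior_Int[OF cvx assms(1)] assms(2) rel
    by (simp add: Int_commute)
qed

lemma sum_weighted_card:
  fixes c :: "'b \<Rightarrow> int"
  assumes "finite N" "finite U"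
  shows "(\<Sum>u\<in>U. c u * int (card {x\<in>N. Q x u})) = (\<Sum>x\<in>N. \<Sum>u\<in>U. if Q x u then c u else 0)"
proof -
  have "c u * int (card {x\<in>N. Q x u}) = (\<Sum>x\<in>N. if Q x u then c u else 0)" for u
    using assms(1) by (simp add: sum.If_cases Int_def)
  then show ?thesis
    using sum.swap by simp
qed

section \<open>Labellings as lattice points\<close>

text \<open>Dividing by \<open>t\<close> moves the lattice points of the dilate back to the
  undilated polytope, so one arrangement serves every \<open>t\<close>.\<close>

definition scaled_point :: "nat \<Rightarrow> ('n::finite \<Rightarrow> int) \<Rightarrow> real ^ 'n" where
  "scaled_point t x = (\<chi> j. real_of_int (x j) / real t)"

lemma lattice_count_eq_card_labellings:
  assumes "0 < t"
  shows "lattice_count t B = card {x. scaled_point t x \<in> B}"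
proof -
  define f :: "('a \<Rightarrow> int) \<Rightarrow> real^'a" where "f = (\<lambda>x. \<chi> j. real_of_int (x j))"
  have f: "f x = real t *\<^sub>R scaled_point t x" for x
    using assms by (simp add: f_def scaled_point_def vec_eq_iff)
  have "{z. (\<forall>j. z $ j \<in> \<int>) \<and> z \<in> (\<lambda>y. real t *\<^sub>R y) ` B} = f ` {x. scaled_point t x \<in> B}"
  proof (intro equalityI subsetI)
    fix z assume "z \<in> {z. (\<forall>j. z $ j \<in> \<int>) \<and> z \<in> (\<lambda>y. real t *\<^sub>R y) ` B}"
    then obtain y where z: "\<And>j. z $ j \<in> \<int>" and y: "y \<in> B" "z = real t *\<^sub>R y"
      by blast
    have "z = f (\<lambda>j. \<lfloor>z $ j\<rfloor>)"
      using z by (simp add: f_def vec_eq_iff)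
    moreover have "scaled_point t (\<lambda>j. \<lfloor>z $ j\<rfloor>) = y"
      using z y(2) assms by (simp add: scaled_point_def vec_eq_iff)
    ultimately show "z \<in> f ` {x. scaled_point t x \<in> B}"
      using y(1) by blast
  next
    fix z assume "z \<in> f ` {x. scaled_point t x \<in> B}"
    then obtain x where x: "scaled_point t x \<in> B" "z = f x"
      by blast
    then have "z \<in> (\<lambda>y. real t *\<^sub>R y) ` B"
      using f by blast
    moreover have "z $ j \<in> \<int>" for j
      by (simp add: x f_def)
    ultimately show "z \<in> {z. (\<forall>j. z $ j \<in> \<int>) \<and> z \<in> (\<lambda>y. real t *\<^sub>R y) ` B}"
      by blast
  qed
  moreover have "inj f"
    by (auto simp: inj_def f_def vec_eq_iff)
  ultimately show ?thesis
    unfolding lattice_count_def by (simp add: card_image inj_on_subset)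
qed

lemma affine_magic_space: "affine (magic_space \<L>)"
  unfolding affine_def magic_space_def
  by (auto simp: sum.distrib simp flip: sum_distrib_left)

lemma scaled_point_in_magic_space:
  assumes "0 < t"
  shows "scaled_point t x \<in> magic_space \<L> \<longleftrightarrow> all_line_sums \<L> x (int t)"
proof -
  have "(\<Sum>j\<in>l. scaled_point t x $ j) = 1 \<longleftrightarrow> (\<Sum>j\<in>l. x j) = int t" for l
  proof -
    have "(\<Sum>j\<in>l. scaled_point t x $ j) = real_of_int (\<Sum>j\<in>l. x j) / real t"
      by (simp add: scaled_point_def sum_divide_distrib)
    also have "\<dots> = 1 \<longleftrightarrow> real_of_int (\<Sum>j\<in>l. x j) = real_of_int (int t)"
      using assms by (auto simp: field_simps)
    finally show ?thesis
      by (simp only: of_int_eq_iff)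
  qed
  then show ?thesis
    by (simp add: magic_space_def all_line_sums_def)
qed

lemma scaled_point_in_orthant:
  assumes "0 < t"
  shows "scaled_point t x \<in> orthant \<longleftrightarrow> (\<forall>j. 0 \<le> x j)"
    "scaled_point t x \<in> open_orthant \<longleftrightarrow> (\<forall>j. 0 < x j)"
  using assms by (auto simp: orthant_def open_orthant_def scaled_point_def zero_le_divide_iff zero_less_divide_iff)

text \<open>The lines cover all points, so each entry is at most the sum of a line through
  it.\<close>

lemma finite_nonneg_labellings:
  fixes \<L> :: "'n::finite set set"
  assumes "covering_clutter UNIV \<L>"
  shows "finite {x. (\<forall>j. 0 \<le> x j) \<and> all_line_sums \<L> x t}"
proof (rule finite_subset)
  show "{x. (\<forall>j. 0 \<le> x j) \<and> all_line_sums \<L> x t} \<subseteq> (\<Pi>\<^sub>E j\<in>UNIV. {0..t})"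
  proof
    fix x assume "x \<in> {x. (\<forall>j. 0 \<le> x j) \<and> all_line_sums \<L> x t}"
    then have x: "\<And>j. 0 \<le> x j" "\<And>l. l \<in> \<L> \<Longrightarrow> (\<Sum>j\<in>l. x j) = t"
      by (auto simp: all_line_sums_def)
    have "x j \<le> t" for j
    proof -
      obtain l where l: "l \<in> \<L>" "j \<in> l"
        using assms unfolding covering_clutter_def by (metis UNIV_I UnionE)
      then have "x j \<le> (\<Sum>j\<in>l. x j)"
        using x(1) by (intro member_le_sum) auto
      then show ?thesis
        using x(2) l by simp
    qed
    then show "x \<in> (\<Pi>\<^sub>E j\<in>UNIV. {0..t})"
      using x(1) by auto
  qed
qed (simp add: finite_PiE)

text \<open>Dividing a positive latin labelling by its line sum gives a point of the open polytope
  off every hyperplane. The line sum is positive because a nonempty line exists.\<close>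

lemma latin_point_exists:
  fixes \<L> :: "'n::finite set set"
  assumes "covering_clutter UNIV \<L>" "positive_latin \<L> x t\<^sub>0"
  shows "\<exists>p\<in>magic_space \<L> \<inter> open_orthant. latin \<L> (($) p)"
proof -
  have x: "latin \<L> x" "\<And>j. 0 < x j" "all_line_sums \<L> x t\<^sub>0"
    using assms(2) by (auto simp: positive_latin_def)
  obtain l where l: "l \<in> \<L>" "l \<noteq> {}"
    using assms(1) by (auto simp: covering_clutter_def)
  have "0 < (\<Sum>j\<in>l. x j)"
    using l(2) x(2) by (intro sum_pos) auto
  then have t0: "0 < t\<^sub>0"
    using l(1) x(3) by (auto simp: all_line_sums_def)
  then have "int (nat t\<^sub>0) = t\<^sub>0" "0 < nat t\<^sub>0"
    by auto
  then have "scaled_point (nat t\<^sub>0) x \<in> magic_space \<L> \<inter> open_orthant"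
    using x by (simp add: scaled_point_in_magic_space scaled_point_in_orthant)
  moreover have "latin \<L> (($) (scaled_point (nat t\<^sub>0) x))"
    using x(1) t0 by (auto simp: latin_def scaled_point_def)
  ultimately show ?thesis by blast
qed

section \<open>Orientations as regions of the edge arrangement\<close>

text \<open>Every edge is indexed twice, as \<open>(i, j)\<close> and \<open>(j, i)\<close>, with opposite normals. Repeated
  hyperplanes do no harm, and the sign pattern of a point is then literally an orientation.\<close>

definition collinear_pairs :: "'n set set \<Rightarrow> ('n \<times> 'n) set" where
  "collinear_pairs \<L> = {(i, j). i \<noteq> j \<and> same_line \<L> i j}"

definition edge_normal :: "'n::finite \<times> 'n \<Rightarrow> real ^ 'n" where
  "edge_normal = (\<lambda>(i, j). axis j 1 - axis i 1)"

lemma edge_normal_inner: "edge_normal (i, j) \<bullet> x = x $ j - x $ i"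
  by (simp add: edge_normal_def inner_diff_left inner_axis')

lemma collinear_pairs_sym: "(i, j) \<in> collinear_pairs \<L> \<longleftrightarrow> (j, i) \<in> collinear_pairs \<L>"
  by (auto simp: collinear_pairs_def same_line_def)

lemma collinear_pairs_iff_edge: "(i, j) \<in> collinear_pairs \<L> \<longleftrightarrow> {i, j} \<in> collinearity_graph \<L>"
  by (auto simp: collinear_pairs_def collinearity_graph_def same_line_def doubleton_eq_iff)

interpretation edges: open_convex_arrangement "open_orthant :: (real ^ 'n::finite) set" edge_normal "\<lambda>_. 0"
  by unfold_locales (fact open_open_orthant convex_open_orthant)+

lemma edges_H: "edges.H (i, j) = hyp i j"
  by (auto simp: edges.H_def hyp_def edge_normal_inner)

text \<open>The sign at \<open>(i, j)\<close> compares coordinates \<open>i\<close> and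
  \<open>j\<close>. Strict signs at a point of the region say that it realizes the orientation; weak
  signs at the scaled labelling say that \<open>x\<close> is compatible.\<close>

lemma regions_eq_realizable_orientations:
  fixes \<L> :: "'n::finite set set"
  assumes "0 < t"
  shows "{T \<in> edges.regions F (collinear_pairs \<L>). \<forall>e\<in>collinear_pairs \<L>.
            if e \<in> T then edge_normal e \<bullet> scaled_point t x \<ge> 0 else edge_normal e \<bullet> scaled_point t x \<le> 0}
       = {\<alpha>. orientation (collinearity_graph \<L>) \<alpha> \<and> acyclic \<alpha> \<and> compatible \<alpha> x \<and>
            realizable_in \<alpha> (F \<inter> open_orthant)}" (is "?L = ?R")
proof (intro equalityI subsetI)
  have le: "edge_normal (i, j) \<bullet> scaled_point t x \<ge> 0 \<longleftrightarrow> x i \<le> x j"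
    "edge_normal (i, j) \<bullet> scaled_point t x \<le> 0 \<longleftrightarrow> x j \<le> x i" for i j
    using assms by (auto simp: edge_normal_inner scaled_point_def divide_le_cancel)
  {
    fix \<alpha> assume "\<alpha> \<in> ?L"
    then obtain p where sub: "\<alpha> \<subseteq> collinear_pairs \<L>" and p: "p \<in> F \<inter> open_orthant"
      and pe: "\<And>e. e \<in> collinear_pairs \<L> \<Longrightarrow>
          if e \<in> \<alpha> then edge_normal e \<bullet> p > 0 else edge_normal e \<bullet> p < 0"
      and xe: "\<And>e. e \<in> collinear_pairs \<L> \<Longrightarrow> if e \<in> \<alpha> then edge_normal e \<bullet> scaled_point t x \<ge> 0
          else edge_normal e \<bullet> scaled_point t x \<le> 0"
      unfolding edges.in_regions_iff by blast
    have p_iff: "(i, j) \<in> \<alpha> \<longleftrightarrow> p $ i < p $ j" if "(i, j) \<in> collinear_pairs \<L>" for i j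
      using pe[OF that] by (auto simp: edge_normal_inner split: if_splits)
    have p_neq: "p $ i \<noteq> p $ j" if "(i, j) \<in> collinear_pairs \<L>" for i j
      using pe[OF that] by (auto simp: edge_normal_inner split: if_splits)
    have p_less: "p $ i < p $ j" if "(i, j) \<in> \<alpha>" for i j
      using that p_iff sub by blast
    have "orientation (collinearity_graph \<L>) \<alpha>"
      unfolding orientation_def collinear_pairs_iff_edge[symmetric]
    proof (intro conjI allI impI)
      show "\<forall>(i, j)\<in>\<alpha>. (i, j) \<in> collinear_pairs \<L>"
        using sub by blast
      fix i j assume ij: "(i, j) \<in> collinear_pairs \<L>"
      then have "(j, i) \<in> collinear_pairs \<L>"
        using collinear_pairs_sym by metis
      then show "(i, j) \<in> \<alpha> \<longleftrightarrow> (j, i) \<notin> \<alpha>"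
        using ij p_iff p_neq by (metis less_asym linorder_less_linear)
    qed
    moreover have "acyclic \<alpha>"
    proof -
      \<comment> \<open>The realizing point increases strictly along directed paths, so no path
        closes up.\<close>
      have "p $ i < p $ j" if "(i, j) \<in> \<alpha>\<^sup>+" for i j
        using that by (induction rule: trancl_induct) (auto dest: p_less)
      then show ?thesis
        by (auto simp: acyclic_def)
    qed
    moreover have "compatible \<alpha> x"
      unfolding compatible_def
    proof safe
      fix i j assume "(i, j) \<in> \<alpha>"
      then show "x i \<le> x j"
        using xe[of "(i, j)"] sub le by auto
    qed
    moreover have "realizable_in \<alpha> (F \<inter> open_orthant)"
      using p p_less unfolding realizable_in_def by blast
    ultimately show "\<alpha> \<in> ?R"
      by blast
  }
  {
    fix \<alpha> assume "\<alpha> \<in> ?R"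
    then have ori: "orientation (collinearity_graph \<L>) \<alpha>" and cmp: "compatible \<alpha> x"
      and "realizable_in \<alpha> (F \<inter> open_orthant)"
      by blast+
    then obtain p where p: "p \<in> F \<inter> open_orthant" "\<And>i j. (i, j) \<in> \<alpha> \<Longrightarrow> p $ i < p $ j"
      unfolding realizable_in_def by blast
    have sub: "\<alpha> \<subseteq> collinear_pairs \<L>"
      using ori unfolding orientation_def by (auto simp: collinear_pairs_iff_edge)
    have rev: "(j, i) \<in> \<alpha>" if "(i, j) \<in> collinear_pairs \<L>" "(i, j) \<notin> \<alpha>" for i j
      using ori that unfolding orientation_def collinear_pairs_iff_edge by blast
    have "if (i, j) \<in> \<alpha> then edge_normal (i, j) \<bullet> p > 0 else edge_normal (i, j) \<bullet> p < 0"
      if "(i, j) \<in> collinear_pairs \<L>" for i j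
      using p(2) rev[OF that] by (auto simp: edge_normal_inner)
    then have "\<alpha> \<in> edges.regions F (collinear_pairs \<L>)"
      unfolding edges.in_regions_iff using sub p(1) by (auto intro!: bexI[of _ p])
    moreover have "if (i, j) \<in> \<alpha> then edge_normal (i, j) \<bullet> scaled_point t x \<ge> 0
        else edge_normal (i, j) \<bullet> scaled_point t x \<le> 0" if "(i, j) \<in> collinear_pairs \<L>" for i j
      using cmp rev[OF that] unfolding compatible_def le by auto
    ultimately show "\<alpha> \<in> ?L"
      by auto
  }
qed

text \<open>Adding small multiples of the all-ones vector \<open>1\<close> makes every coordinate
  positive.\<close>

lemma orthant_subset_closure: "(orthant :: (real ^ 'n::finite) set) \<subseteq> closure open_orthant"
proof
  fix x :: "real^'n" assume x: "x \<in> orthant"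
  have "(\<lambda>n. x + (1 / real (Suc n)) *\<^sub>R 1) \<longlonglongrightarrow> x + 0 *\<^sub>R 1"
    by (intro tendsto_intros LIMSEQ_Suc lim_1_over_n)
  moreover have "x + (1 / real (Suc n)) *\<^sub>R 1 \<in> open_orthant" for n
    using x by (auto simp: orthant_def open_orthant_def intro!: add_nonneg_pos)
  ultimately show "x \<in> closure open_orthant"
    unfolding closure_sequential
    by (intro exI[of _ "\<lambda>n. x + (1 / real (Suc n)) *\<^sub>R 1"]) simp
qed

theorem theorem4p8:
  fixes \<L> :: "'n::finite set set" and t :: nat
  assumes "covering_clutter (UNIV :: 'n set) \<L>"
    and "\<forall>l\<in>\<L>. \<forall>m\<in>\<L>. card l = card m"
    and "\<exists>x t\<^sub>0. positive_latin \<L> x t\<^sub>0"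
    and "0 < t"
  shows "let s = magic_space \<L>;
             P\<^sub>0 = rel_interior (magic_polytope \<L>);
             \<H> = arrangement \<L>;
             \<Lambda> = intersection_poset P\<^sub>0 \<H>
         in int (positive_latin_count \<L> t) =
              (\<Sum>u\<in>\<Lambda>. poset_moebius \<Lambda> P\<^sub>0 u *
                 int (lattice_count t (flat_of s P\<^sub>0 \<H> u \<inter> open_orthant))) \<and>
            int (oriented_labelling_count \<L> t) =
              (\<Sum>u\<in>\<Lambda>. \<bar>poset_moebius \<Lambda> P\<^sub>0 u\<bar> *
                 int (lattice_count t (flat_of s P\<^sub>0 \<H> u \<inter> orthant)))"
proof -
  define F where "F = magic_space \<L>"
  define E where "E = collinear_pairs \<L>"
  define A where "A = open_orthant \<inter> F"
  define \<H> where "\<H> = arrangement \<L>"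
  define \<Lambda> where "\<Lambda> = edges.cuts F E"
  define N where "N = {x. (\<forall>j. 0 \<le> x j) \<and> all_line_sums \<L> x (int t)}"
  have aff: "affine F"
    unfolding F_def by (rule affine_magic_space)
  have finE: "finite E"
    by simp
  obtain p where p: "p \<in> A" "latin \<L> (($) p)"
    using latin_point_exists[OF assms(1)] assms(3) unfolding A_def F_def by blast
  have p_off: "p \<notin> edges.H e" if "e \<in> E" for e
    using p(2) that by (cases e) (auto simp: E_def collinear_pairs_def latin_def edges_H hyp_def)
  have not_sub: "\<not> A \<subseteq> edges.H e" if "e \<in> E" for e
    using p(1) p_off[OF that] by blast
  have P0: "rel_interior (magic_polytope \<L>) = A"
    unfolding magic_polytope_def F_def[symmetric] A_def
    using rel_interior_affine_Int_orthant[OF aff] p(1) by (auto simp: A_def)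
  \<comment> \<open>The latin point \<open>p\<close> shows that no edge hyperplane contains the
    whole space, so every edge contributes to the arrangement.\<close>
  have \<H>: "\<H> = (\<lambda>e. edges.H e \<inter> F) ` E"
  proof (intro equalityI subsetI)
    fix h assume "h \<in> \<H>"
    then show "h \<in> (\<lambda>e. edges.H e \<inter> F) ` E"
      unfolding \<H>_def arrangement_def collinear_pairs_iff_edge[symmetric] F_def E_def
      by (auto simp: edges_H[symmetric])
  next
    fix h assume "h \<in> (\<lambda>e. edges.H e \<inter> F) ` E"
    then obtain i j where ij: "(i, j) \<in> E" "h = hyp i j \<inter> F"
      by (auto simp: edges_H)
    moreover have "\<not> F \<subseteq> hyp i j"
      using p(1) p_off[OF ij(1)] by (auto simp: edges_H A_def)
    ultimately show "h \<in> \<H>"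
      unfolding \<H>_def arrangement_def collinear_pairs_iff_edge[symmetric] F_def E_def by blast
  qed
  have flat: "F \<inter> \<Inter> ((\<lambda>e. edges.H e \<inter> F) ` T) = edges.flat F T" for T
    by (auto simp: edges.flat_def)
  have cut: "A \<inter> edges.flat F T = edges.cut F T" for T
    by (auto simp: edges.cut_def edges.flat_def A_def)
  have cut': "A \<inter> \<Inter> ((\<lambda>e. edges.H e \<inter> F) ` T) = edges.cut F T" for T
    by (auto simp: edges.cut_def edges.flat_def A_def)
  have poset: "intersection_poset A \<H> = \<Lambda>"
  proof -
    have "{A \<inter> \<Inter>\<S> | \<S>. \<S> \<subseteq> \<H>} = {A \<inter> \<Inter> ((\<lambda>e. edges.H e \<inter> F) ` T) | T. T \<subseteq> E}"
      unfolding \<H> subset_image_iff by blast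
    also have "\<dots> = edges.cut F ` Pow E"
      unfolding cut' by blast
    finally show ?thesis
      by (simp add: intersection_poset_def \<Lambda>_def edges.cuts_def)
  qed
  \<comment> \<open>Any flat that cuts out \<open>u\<close> equals the affine hull of
    \<open>u\<close>, which gives the uniqueness behind \<open>THE\<close>.\<close>
  have flat_of: "flat_of F A \<H> u = affine hull u" and u_eq: "u = open_orthant \<inter> affine hull u"
    and hull_sub: "affine hull u \<subseteq> F" if u: "u \<in> \<Lambda>" for u
  proof -
    obtain T where T: "T \<subseteq> E" "u = edges.cut F T" "u \<noteq> {}"
      using u unfolding \<Lambda>_def edges.cuts_def by blast
    have hull: "affine hull u = edges.flat F T"
      using edges.affine_hull_cut[OF aff] T by simp
    show "u = open_orthant \<inter> affine hull u"
      unfolding hull using T(2) by (simp add: edges.cut_def)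
    show "affine hull u \<subseteq> F"
      unfolding hull by (auto simp: edges.flat_def)
    show "flat_of F A \<H> u = affine hull u"
      unfolding flat_of_def
    proof (rule the_equality)
      show "\<exists>\<S>\<subseteq>\<H>. affine hull u = F \<inter> \<Inter>\<S> \<and> A \<inter> affine hull u = u"
        unfolding \<H> using T flat[of T] cut[of T] hull
        by (intro exI[of _ "(\<lambda>e. edges.H e \<inter> F) ` T"]) auto
    next
      fix f assume "\<exists>\<S>\<subseteq>\<H>. f = F \<inter> \<Inter>\<S> \<and> A \<inter> f = u"
      then obtain T' where "f = F \<inter> \<Inter> ((\<lambda>e. edges.H e \<inter> F) ` T')" "A \<inter> f = u"
        unfolding \<H> subset_image_iff by blast
      then have "f = edges.flat F T'" "A \<inter> f = u"
        by (simp_all only: flat)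
      then show "f = affine hull u"
        using edges.affine_hull_cut[OF aff, of T'] T(3) cut[of T'] by simp
    qed
  qed
  have moebius: "poset_moebius \<Lambda> A u = edges.whitney F E u" if "u \<in> \<Lambda>" for u
    using edges.moebius_eq_whitney[OF finE, of F u] that p(1) not_sub
    unfolding \<Lambda>_def A_def by blast
  have fin\<Lambda>: "finite \<Lambda>"
    unfolding \<Lambda>_def by (rule edges.finite_cuts[OF finE])
  have finN: "finite N"
    unfolding N_def by (rule finite_nonneg_labellings[OF assms(1)])
  have N: "x \<in> N \<longleftrightarrow> scaled_point t x \<in> F \<inter> orthant" for x
    using assms(4) by (auto simp: N_def F_def scaled_point_in_magic_space scaled_point_in_orthant)
  define N0 where "N0 = {x\<in>N. scaled_point t x \<in> A}"
  have N0: "x \<in> N0 \<longleftrightarrow> scaled_point t x \<in> A" for x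
    by (auto simp: N0_def N A_def open_orthant_def orthant_def less_imp_le)
  have finN0: "finite N0"
    using finN by (simp add: N0_def)

  have "(\<Sum>u\<in>\<Lambda>. poset_moebius \<Lambda> A u * int (lattice_count t (flat_of F A \<H> u \<inter> open_orthant)))
      = (\<Sum>u\<in>\<Lambda>. edges.whitney F E u * int (card {x\<in>N0. scaled_point t x \<in> u}))"
  proof (rule sum.cong[OF refl])
    fix u assume u: "u \<in> \<Lambda>"
    have "affine hull u \<inter> open_orthant = u"
      using u_eq[OF u] by blast
    moreover have "u \<subseteq> A"
      using u_eq[OF u] hull_sub[OF u] unfolding A_def by blast
    then have "{x. scaled_point t x \<in> u} = {x\<in>N0. scaled_point t x \<in> u}"
      using N0 by blast
    ultimately show "poset_moebius \<Lambda> A u * int (lattice_count t (flat_of F A \<H> u \<inter> open_orthant))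
        = edges.whitney F E u * int (card {x\<in>N0. scaled_point t x \<in> u})"
      by (simp add: moebius[OF u] flat_of[OF u] lattice_count_eq_card_labellings[OF assms(4)])
  qed
  also have "\<dots> = (\<Sum>x\<in>N0. \<Sum>u\<in>\<Lambda>. if scaled_point t x \<in> u then edges.whitney F E u else 0)"
    by (rule sum_weighted_card[OF finN0 fin\<Lambda>])
  \<comment> \<open>Inclusion-exclusion at each lattice point: \<open>sum_whitney_superset\<close>
    for the singleton of that point.\<close>
  also have "\<dots> = (\<Sum>x\<in>N0. if \<forall>e\<in>E. scaled_point t x \<notin> edges.H e then 1 else 0)"
  proof (rule sum.cong[OF refl])
    fix x assume "x \<in> N0"
    then show "(\<Sum>u\<in>\<Lambda>. if scaled_point t x \<in> u then edges.whitney F E u else 0)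
        = (if \<forall>e\<in>E. scaled_point t x \<notin> edges.H e then 1 else 0)"
      using edges.sum_whitney_superset[OF finE, of "{scaled_point t x}" F] fin\<Lambda>
      by (simp add: \<Lambda>_def[symmetric] N0 A_def sum.inter_filter)
  qed
  also have "\<dots> = int (card {x\<in>N0. \<forall>e\<in>E. scaled_point t x \<notin> edges.H e})"
    using finN0 by (simp add: sum.If_cases Int_def)
  also have "{x\<in>N0. \<forall>e\<in>E. scaled_point t x \<notin> edges.H e} = {x. positive_latin \<L> x (int t)}"
  proof -
    have "(\<forall>e\<in>E. scaled_point t x \<notin> edges.H e) \<longleftrightarrow> latin \<L> x" for x
      using assms(4)
      by (auto simp: E_def collinear_pairs_def latin_def edges_H hyp_def scaled_point_def)
    then show ?thesis
      using assms(4)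
      by (auto simp: N0 A_def F_def positive_latin_def scaled_point_in_magic_space
          scaled_point_in_orthant)
  qed
  finally have part1: "int (positive_latin_count \<L> t) =
      (\<Sum>u\<in>\<Lambda>. poset_moebius \<Lambda> A u * int (lattice_count t (flat_of F A \<H> u \<inter> open_orthant)))"
    by (simp add: positive_latin_count_def)

  \<comment> \<open>The orientations paired with \<open>x\<close>, so that \<open>Sigma N Or\<close>
    is the set of pairs to be counted.\<close>
  define Or where "Or = (\<lambda>x. {\<alpha>. orientation (collinearity_graph \<L>) \<alpha> \<and> acyclic \<alpha> \<and>
      compatible \<alpha> x \<and> realizable_in \<alpha> A})"
  have "(\<Sum>u\<in>\<Lambda>. \<bar>poset_moebius \<Lambda> A u\<bar> * int (lattice_count t (flat_of F A \<H> u \<inter> orthant)))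
      = (\<Sum>u\<in>\<Lambda>. \<bar>edges.whitney F E u\<bar> * int (card {x\<in>N. scaled_point t x \<in> affine hull u}))"
  proof (rule sum.cong[OF refl])
    fix u assume u: "u \<in> \<Lambda>"
    have "{x. scaled_point t x \<in> affine hull u \<inter> orthant} = {x\<in>N. scaled_point t x \<in> affine hull u}"
      using hull_sub[OF u] N by blast
    then show "\<bar>poset_moebius \<Lambda> A u\<bar> * int (lattice_count t (flat_of F A \<H> u \<inter> orthant))
        = \<bar>edges.whitney F E u\<bar> * int (card {x\<in>N. scaled_point t x \<in> affine hull u})"
      by (simp only: moebius[OF u] flat_of[OF u] lattice_count_eq_card_labellings[OF assms(4)])
  qed
  also have "\<dots> = (\<Sum>x\<in>N. \<Sum>u\<in>\<Lambda>. if scaled_point t x \<in> affine hull u then \<bar>edges.whitney F E u\<bar> else 0)"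
    by (rule sum_weighted_card[OF finN fin\<Lambda>])
  also have "\<dots> = (\<Sum>x\<in>N. int (card (Or x)))"
  proof (rule sum.cong[OF refl])
    fix x assume "x \<in> N"
    then have y: "scaled_point t x \<in> F" "scaled_point t x \<in> closure open_orthant"
      using N orthant_subset_closure by blast+
    let ?E = "{e\<in>E. scaled_point t x \<in> edges.H e}"
    have ne: "{} \<notin> \<Lambda>"
      by (simp add: \<Lambda>_def edges.cuts_def)
    \<comment> \<open>Cuts of the hyperplanes through the point are among those of the whole
      arrangement, so Zaslavsky's theorem may be summed over all of
      \<open>\<Lambda>\<close>.\<close>
    have sub: "edges.cuts F ?E \<subseteq> \<Lambda>"
      by (auto simp: \<Lambda>_def edges.cuts_def)
    have "(\<Sum>u\<in>\<Lambda>. if scaled_point t x \<in> affine hull u then \<bar>edges.whitney F E u\<bar> else 0)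
        = (\<Sum>u\<in>\<Lambda>. \<bar>edges.whitney F ?E u\<bar>)"
    proof (rule sum.cong[OF refl])
      fix u assume "u \<in> \<Lambda>"
      then have "u \<noteq> {}" using ne by blast
      then show "(if scaled_point t x \<in> affine hull u then \<bar>edges.whitney F E u\<bar> else 0)
          = \<bar>edges.whitney F ?E u\<bar>"
        by (simp add: edges.whitney_localize[OF finE aff _ y(1)])
    qed
    also have "\<dots> = int (card (edges.regions F ?E))"
      using edges.card_regions_eq_sum_whitney[OF _ aff fin\<Lambda> ne sub] by simp
    \<comment> \<open>Local regions at the point correspond to global regions whose closure contains
      it, and those are the compatible orientations.\<close>
    also have "card (edges.regions F ?E) = card (Or x)"
      using edges.card_regions_at[OF finE aff y] regions_eq_realizable_orientations[OF assms(4), of F \<L> x]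
      by (simp only: E_def Or_def A_def Int_commute)
    finally show "(\<Sum>u\<in>\<Lambda>. if scaled_point t x \<in> affine hull u then \<bar>edges.whitney F E u\<bar> else 0)
        = int (card (Or x))" .
  qed
  also have "\<dots> = int (card (Sigma N Or))"
    using finN by simp
  also have "Sigma N Or = {(x, \<alpha>).
       (\<forall>j. 0 \<le> x j) \<and> all_line_sums \<L> x (int t) \<and>
       orientation (collinearity_graph \<L>) \<alpha> \<and> acyclic \<alpha> \<and> compatible \<alpha> x \<and> realizable_in \<alpha> A}"
    by (auto simp: N_def Or_def)
  finally have part2: "int (oriented_labelling_count \<L> t) =
      (\<Sum>u\<in>\<Lambda>. \<bar>poset_moebius \<Lambda> A u\<bar> * int (lattice_count t (flat_of F A \<H> u \<inter> orthant)))"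
    by (simp add: oriented_labelling_count_def P0)

  show ?thesis
    unfolding Let_def P0 F_def[symmetric] \<H>_def[symmetric] poset
    using part1 part2 by blast
qed

end
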